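(* Let $(X,p)$ be a partial metric space, let $r\ge 0$, let $\{x_n\}$ be a sequence in $X$ that is $r$-convergent from right, and let $\{y_n\}$ be a sequence in $R\text{-}LIM^{r}x_n$ that converges to $y\in X$. Then $y\in R\text{-}LIM^{r}x_n$.
   Context: A partial metric on a nonempty set $X$ is a function $p:X\times X\to[0,\infty)$ such that for all $x,y,z\in X$: (p1) $0\le p(x,x)\le p(x,y)$; (p2) $x=y \iff p(x,x)=p(x,y)=p(y,y)$; (p3) $p(x,y)=p(y,x)$; (p4) $p(x,y)\le p(x,z)+p(z,y)-p(z,z)$. The pair $(X,p)$ is a partial metric space. A sequence $\{x_n\}$ in $X$ converges to $x\in X$ if for every $\epsilon>0$ there is $k\in\mathbb{N}$ such that $|p(x_n,x)-p(x,x)|<\epsilon$ for all $n\ge k$. A sequence $\{x_n\}$ is $r$-convergent to $x$ from right if for every $\epsilon>0$ there is $k\in\mathbb{N}$ such that $|p(x_n,x)-p(x,x)|<r+\epsilon$ for all $n\ge k$ with $p(x_n,x)\ge p(x,x)$. It is $r$-convergent from right if this holds for some $x\in X$. $R\text{-}LIM^{r}x_n$ denotes the set of all $x\in X$ such that $\{x_n\}$ is $r$-convergent to $x$ from right. *)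

theory Defs
  imports Complex_Main
begin

text \<open>The codomain \<open>[0,\<infinity>)\<close> of a partial metric is enforced on the carrier by axioms \<open>p1_nonneg\<close>
  and \<open>p1_le\<close>; the values of \<open>p\<close> outside the carrier are irrelevant.\<close>

locale partial_metric_space =
  fixes X :: "'a set" and p :: "'a \<Rightarrow> 'a \<Rightarrow> real"
  assumes nonempty: "X \<noteq> {}"
    and p1_nonneg: "\<And>x. x \<in> X \<Longrightarrow> 0 \<le> p x x"
    and p1_le: "\<And>x y. x \<in> X \<Longrightarrow> y \<in> X \<Longrightarrow> p x x \<le> p x y"
    and p2: "\<And>x y. x \<in> X \<Longrightarrow> y \<in> X \<Longrightarrow> x = y \<longleftrightarrow> p x x = p x y \<and> p x y = p y y"
    and p3: "\<And>x y. x \<in> X \<Longrightarrow> y \<in> X \<Longrightarrow> p x y = p y x"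
    and p4: "\<And>x y z. x \<in> X \<Longrightarrow> y \<in> X \<Longrightarrow> z \<in> X \<Longrightarrow> p x y \<le> p x z + p z y - p z z"

definition pm_converges_to :: "('a \<Rightarrow> 'a \<Rightarrow> real) \<Rightarrow> (nat \<Rightarrow> 'a) \<Rightarrow> 'a \<Rightarrow> bool" where
  "pm_converges_to p u x \<longleftrightarrow>
     (\<forall>\<epsilon>>0. \<exists>k. \<forall>n\<ge>k. \<bar>p (u n) x - p x x\<bar> < \<epsilon>)"

definition rough_converges_right_to ::
    "('a \<Rightarrow> 'a \<Rightarrow> real) \<Rightarrow> real \<Rightarrow> (nat \<Rightarrow> 'a) \<Rightarrow> 'a \<Rightarrow> bool" where
  "rough_converges_right_to p r u x \<longleftrightarrow>
     (\<forall>\<epsilon>>0. \<exists>k. \<forall>n\<ge>k. p (u n) x \<ge> p x x \<longrightarrow> \<bar>p (u n) x - p x x\<bar> < r + \<epsilon>)"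

definition rough_convergent_right ::
    "'a set \<Rightarrow> ('a \<Rightarrow> 'a \<Rightarrow> real) \<Rightarrow> real \<Rightarrow> (nat \<Rightarrow> 'a) \<Rightarrow> bool" where
  "rough_convergent_right X p r u \<longleftrightarrow> (\<exists>x\<in>X. rough_converges_right_to p r u x)"

definition R_LIM ::
    "'a set \<Rightarrow> ('a \<Rightarrow> 'a \<Rightarrow> real) \<Rightarrow> real \<Rightarrow> (nat \<Rightarrow> 'a) \<Rightarrow> 'a set" where
  "R_LIM X p r u = {x \<in> X. rough_converges_right_to p r u x}"

end

theory Submission
  imports Defs
begin

text \<open>Approximate the limit \<open>l\<close> by a single term \<open>y m\<close> and pass
  through it with the triangle inequality \<open>p4\<close>. The self-distance
  \<open>p (y m) (y m)\<close> that \<open>p4\<close> subtracts is exactly the one that rough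
  convergence to \<open>y m\<close> measures against, so the excess of \<open>p (x n) l\<close> over
  \<open>p l l\<close> splits into less than r + \<epsilon>/2 from \<open>x\<close> and less than
  \<epsilon>/2 from \<open>y\<close>.\<close>

theorem theorem3p6:
  fixes X :: "'a set" and p :: "'a \<Rightarrow> 'a \<Rightarrow> real" and r :: real
    and x y :: "nat \<Rightarrow> 'a" and l :: 'a
  assumes "partial_metric_space X p"
    and "r \<ge> 0"
    and "\<And>n. x n \<in> X"
    and "rough_convergent_right X p r x"
    and "\<And>n. y n \<in> R_LIM X p r x"
    and "l \<in> X"
    and "pm_converges_to p y l"
  shows "l \<in> R_LIM X p r x"
proof -
  interpret partial_metric_space X p by fact
  have "rough_converges_right_to p r x l"
    unfolding rough_converges_right_to_def
  proof (intro allI impI)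
    fix \<epsilon> :: real assume "\<epsilon> > 0"
    then have half: "\<epsilon> / 2 > 0" by simp
    \<comment> \<open>The index \<open>m\<close> depends only on \<epsilon> and is fixed before
      \<open>k\<close>, so \<open>k\<close> may depend on it.\<close>
    obtain m where "\<bar>p (y m) l - p l l\<bar> < \<epsilon> / 2"
      using assms(7) half unfolding pm_converges_to_def by blast
    then have near: "p (y m) l < p l l + \<epsilon> / 2" by linarith
    have ym: "y m \<in> X" and "rough_converges_right_to p r x (y m)"
      using assms(5)[of m] by (auto simp: R_LIM_def)
    then obtain k where k: "p (x n) (y m) \<ge> p (y m) (y m) \<longrightarrow>
        \<bar>p (x n) (y m) - p (y m) (y m)\<bar> < r + \<epsilon> / 2" if "n \<ge> k" for n
      using half unfolding rough_converges_right_to_def by meson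
    have "\<bar>p (x n) l - p l l\<bar> < r + \<epsilon>" if "n \<ge> k" and "p (x n) l \<ge> p l l" for n
    proof -
      \<comment> \<open>By minimality of self-distance and symmetry, the guard in rough convergence
        to \<open>y m\<close> holds, which releases its bound.\<close>
      have "p (x n) (y m) \<ge> p (y m) (y m)"
        using p1_le[OF ym assms(3)] p3[OF ym assms(3)] by simp
      then have "p (x n) (y m) - p (y m) (y m) < r + \<epsilon> / 2"
        using k[OF \<open>n \<ge> k\<close>] by linarith
      \<comment> \<open>The assumed guard at \<open>l\<close> lets the absolute value be dropped, so
        the upper estimate from \<open>p4\<close> suffices.\<close>
      then show ?thesis
        using p4[OF assms(3) assms(6) ym, of n] near \<open>p (x n) l \<ge> p l l\<close> by linarith
    qed
    then show "\<exists>k. \<forall>n\<ge>k. p (x n) l \<ge> p l l \<longrightarrow> \<bar>p (x n) l - p l l\<bar> < r + \<epsilon>"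
      by blast
  qed
  then show ?thesis
    using assms(6) by (simp add: R_LIM_def)
qed

end
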